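(* Let $G$ be a finite group of order $2v$ with a normal subgroup $N = \{1,z\}$ of order $2$, and let $S \subseteq G$ be a $(2v,2k+1,2\beta)$ sum set which is type 2 with respect to $N$. Then $P = \{sN : s \in S \setminus N\}$ is a $(v,k,\beta-1,\beta)$ partial sum set in $G/N$.
   Context: For a finite group $X$ of order $w$, a subset $T \subseteq X$ with $|T| = k$ and $a \in X$, the number of ways to write $a$ as a product in $T$ is the number of ordered pairs $(x,y)\in T\times T$ with $xy=a$. $T$ is a $(w,k,\lambda,\mu)$ partial sum set if every nonidentity element of $T$ is a product in $T$ in exactly $\lambda$ ways and every nonidentity element of $X\setminus T$ is a product in $T$ in exactly $\mu$ ways; if $\lambda=\mu$, $T$ is a $(w,k,\mu)$ sum set. A sum set $S$ is type 2 with respect to $N$ if $|S\cap N| = 1$ and $S$ meets each other coset of $N$ in $0$ or $2$ elements. *)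

theory Defs
  imports "HOL-Algebra.Coset"
begin

definition product_ways :: "('a, 'b) monoid_scheme \<Rightarrow> 'a set \<Rightarrow> 'a \<Rightarrow> nat" where
  "product_ways X T a = card {(x, y) \<in> T \<times> T. x \<otimes>\<^bsub>X\<^esub> y = a}"

text \<open>
  The parameters \<open>\<lambda>\<close> (here \<open>l\<close>) and \<open>\<mu>\<close> (here \<open>m\<close>) are integers, so that parameters such as
  \<open>\<beta> - 1\<close> are not subject to truncated subtraction.
\<close>

definition partial_sum_set ::
    "('a, 'b) monoid_scheme \<Rightarrow> nat \<Rightarrow> nat \<Rightarrow> int \<Rightarrow> int \<Rightarrow> 'a set \<Rightarrow> bool" where
  "partial_sum_set X w k l m T \<longleftrightarrow>
     group X \<and> finite (carrier X) \<and> order X = w \<and>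
     T \<subseteq> carrier X \<and> card T = k \<and>
     (\<forall>a \<in> T. a \<noteq> \<one>\<^bsub>X\<^esub> \<longrightarrow> int (product_ways X T a) = l) \<and>
     (\<forall>a \<in> carrier X - T. a \<noteq> \<one>\<^bsub>X\<^esub> \<longrightarrow> int (product_ways X T a) = m)"

definition sum_set :: "('a, 'b) monoid_scheme \<Rightarrow> nat \<Rightarrow> nat \<Rightarrow> int \<Rightarrow> 'a set \<Rightarrow> bool" where
  "sum_set X w k m T \<longleftrightarrow> partial_sum_set X w k m m T"

text \<open>
  Intended for normal \<open>N\<close>, where left and right cosets agree.
\<close>

definition type2 :: "('a, 'b) monoid_scheme \<Rightarrow> 'a set \<Rightarrow> 'a set \<Rightarrow> bool" where
  "type2 X N S \<longleftrightarrow>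
     card (S \<inter> N) = 1 \<and>
     (\<forall>C \<in> rcosets\<^bsub>X\<^esub> N. C \<noteq> N \<longrightarrow> card (S \<inter> C) = 0 \<or> card (S \<inter> C) = 2)"

end

theory Submission
  imports Defs
begin

text \<open>
  A coset of \<open>N\<close> has two elements, so \<open>S\<close> consists of a single element \<open>s0\<close> of \<open>N\<close> and of
  \<open>k\<close> full cosets, whose union is \<open>D = S - N\<close>. For \<open>g \<notin> N\<close> every way of writing \<open>gN\<close> as a
  product in \<open>P\<close> lifts to exactly two ways of writing \<open>g\<close> as a product in \<open>D\<close>. The remaining
  ways of writing \<open>g\<close> as a product in \<open>S\<close> involve \<open>s0\<close> exactly once; there are two of them if
  \<open>g \<in> D\<close> and none otherwise. Halving the resulting count of \<open>2\<beta>\<close> gives the claim.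
\<close>

lemma (in normal) rcos_in_FactGroup: "x \<in> carrier G \<Longrightarrow> H #> x \<in> carrier (G Mod H)"
  by (auto simp: FactGroup_def RCOSETS_def)

text \<open>Right cosets partition the group, so the only coset that can contain \<open>x\<close> is
  \<open>H #> x\<close>.\<close>

lemma (in subgroup) mem_rcoset_iff:
  assumes "group G" "A \<in> rcosets H"
  shows "x \<in> A \<longleftrightarrow> x \<in> carrier G \<and> H #> x = A"
proof -
  interpret group G by fact
  obtain a where a: "a \<in> carrier G" "A = H #> a"
    using assms(2) by (auto simp: RCOSETS_def)
  show ?thesis
    using a by (metis repr_independence rcos_self is_subgroup r_coset_subset_G subset subsetD)
qed

text \<open>Passing to the preimage of \<open>P\<close> under the projection turns membership in a
  union into a condition on a single coset.\<close>

lemma (in normal) Union_cosets: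
  assumes "P \<subseteq> carrier (G Mod H)"
  shows "\<Union>P = {x \<in> carrier G. H #> x \<in> P}"
proof -
  have "P \<subseteq> rcosets H" using assms by (simp add: FactGroup_def)
  then have mem: "x \<in> A \<longleftrightarrow> x \<in> carrier G \<and> H #> x = A" if "A \<in> P" for x A
    using mem_rcoset_iff[OF is_group] that by blast
  show ?thesis
  proof (rule Set.set_eqI)
    fix x
    show "x \<in> \<Union>P \<longleftrightarrow> x \<in> {x \<in> carrier G. H #> x \<in> P}"
      unfolding Union_iff mem_Collect_eq using mem by metis
  qed
qed

lemma (in normal) card_Union_cosets:
  assumes "finite (carrier G)" "P \<subseteq> carrier (G Mod H)"
  shows "card (\<Union>P) = card H * card P"
proof -
  have P: "P \<subseteq> rcosets H" using assms(2) by (simp add: FactGroup_def)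
  have "finite (rcosets H)"
    using assms(1) by (simp add: RCOSETS_def)
  then have "finite P" using P finite_subset by blast
  moreover have "finite (\<Union>P)"
    using assms by (simp add: Union_cosets)
  ultimately have "card H * card P = card (\<Union>P)"
    using P rcos_disjoint[OF is_subgroup] card_rcosets_equal[OF _ subset]
    by (intro card_partition) (auto simp: pairwise_def disjnt_def)
  then show ?thesis by simp
qed

text \<open>Suppose \<open>A\<close> times \<open>B\<close> is the coset of \<open>g\<close>. Any
  \<open>x\<close> in \<open>A\<close> may serve as first factor; the second is then forced to be
  \<open>inv x \<otimes> g\<close>, which lies in \<open>B\<close> automatically. So each way in the
  quotient lifts to as many ways as \<open>A\<close> has elements, namely
  \<open>card H\<close>.\<close>

lemma (in normal) product_ways_Union_cosets:
  assumes fin: "finite (carrier G)" and P: "P \<subseteq> carrier (G Mod H)" and g: "g \<in> carrier G"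
  shows "product_ways G (\<Union>P) g = card H * product_ways (G Mod H) P (H #> g)"
proof -
  let ?W = "{(x, y) \<in> \<Union>P \<times> \<Union>P. x \<otimes> y = g}"
  define V where "V = {(A, B) \<in> P \<times> P. A \<otimes>\<^bsub>G Mod H\<^esub> B = H #> g}"
  have PR: "P \<subseteq> rcosets H" using P by (simp add: FactGroup_def)
  have mem: "x \<in> A \<longleftrightarrow> x \<in> carrier G \<and> H #> x = A" if "A \<in> P" for x A
    using mem_rcoset_iff[OF is_group] PR that by blast
  have U: "\<Union>P = {x \<in> carrier G. H #> x \<in> P}"
    using P by (rule Union_cosets)
  have finV: "finite V"
  proof -
    have "finite P" using PR fin by (auto simp: RCOSETS_def intro: finite_subset)
    then show ?thesis
      by (auto simp: V_def intro: finite_subset[of _ "P \<times> P"])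
  qed
  \<comment> \<open>This cancels the coset of \<open>x\<close> in the quotient, by multiplying from
    the left with the coset of \<open>inv x\<close>.\<close>
  have quot: "H #> (inv x \<otimes> g) = B"
    if "x \<in> carrier G" "B \<in> P" "(H #> x) <#> B = H #> g" for x B
  proof -
    obtain b where b: "b \<in> carrier G" "B = H #> b"
      using subsetD[OF PR \<open>B \<in> P\<close>] by (auto simp: RCOSETS_def)
    have "H #> (x \<otimes> b) = H #> g"
      using that b by (simp add: rcos_sum)
    then have "(H #> inv x) <#> (H #> (x \<otimes> b)) = (H #> inv x) <#> (H #> g)"
      by simp
    then show ?thesis
      using that b g by (simp add: rcos_sum m_assoc[symmetric])
  qed
  have lift: "x \<in> carrier G" "H #> x = A" "A \<in> P" "B \<in> P" "H #> (inv x \<otimes> g) = B"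
    if "(A, B) \<in> V" "x \<in> A" for A B x
  proof -
    show *: "A \<in> P" "B \<in> P" using that by (auto simp: V_def)
    show "x \<in> carrier G" "H #> x = A" using mem[OF *(1)] that(2) by blast+
    then show "H #> (inv x \<otimes> g) = B" using that *(2) by (intro quot) (auto simp: V_def)
  qed
  have cancel: "x \<otimes> (inv x \<otimes> g) = g" if "x \<in> carrier G" for x
    using that g by (simp add: m_assoc[symmetric])
  \<comment> \<open>A lifted way is encoded by the pair of cosets below it together with its first
    factor; the second factor carries no further information.\<close>
  have "bij_betw (\<lambda>(p, x). (x, inv x \<otimes> g)) (SIGMA p:V. fst p) ?W"
  proof (rule bij_betw_byWitness[where f' = "\<lambda>(x, y). ((H #> x, H #> y), x)"])
    show "\<forall>a\<in>SIGMA p:V. fst p.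
        (\<lambda>(x, y). ((H #> x, H #> y), x)) ((\<lambda>(p, x). (x, inv x \<otimes> g)) a) = a"
    proof
      fix a
      assume "a \<in> (SIGMA p:V. fst p)"
      then obtain A B x where a: "a = ((A, B), x)" "(A, B) \<in> V" "x \<in> A"
        by (cases a) auto
      then show "(\<lambda>(x, y). ((H #> x, H #> y), x)) ((\<lambda>(p, x). (x, inv x \<otimes> g)) a) = a"
        using lift(2,5)[OF a(2,3)] by simp
    qed
    show "\<forall>a\<in>?W. (\<lambda>(p, x). (x, inv x \<otimes> g)) ((\<lambda>(x, y). ((H #> x, H #> y), x)) a) = a"
      unfolding U by (auto simp: m_assoc[symmetric])
    show "(\<lambda>(p, x). (x, inv x \<otimes> g)) ` (SIGMA p:V. fst p) \<subseteq> ?W"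
    proof (rule image_subsetI)
      fix a
      assume "a \<in> (SIGMA p:V. fst p)"
      then obtain A B x where a: "a = ((A, B), x)" "(A, B) \<in> V" "x \<in> A"
        by (cases a) auto
      then show "(\<lambda>(p, x). (x, inv x \<otimes> g)) a \<in> ?W"
        using lift[OF a(2,3)] g cancel by (simp add: U)
    qed
    show "(\<lambda>(x, y). ((H #> x, H #> y), x)) ` ?W \<subseteq> (SIGMA p:V. fst p)"
      unfolding U V_def by (auto simp: rcos_sum rcos_self is_subgroup)
  qed
  then have "card ?W = card (SIGMA p:V. fst p)"
    by (simp add: bij_betw_same_card)
  also have "\<dots> = (\<Sum>p\<in>V. card (fst p))"
  proof (rule card_SigmaI[OF finV])
    show "\<forall>p\<in>V. finite (fst p)"
    proof
      fix p
      assume "p \<in> V"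
      then have "fst p \<subseteq> carrier G" using lift(1)[of "fst p" "snd p"] by auto
      then show "finite (fst p)" using fin finite_subset by blast
    qed
  qed
  also have "\<dots> = (\<Sum>p\<in>V. card H)"
    using PR card_rcosets_equal[OF _ subset] by (intro sum.cong) (auto simp: V_def)
  finally show ?thesis by (simp add: product_ways_def V_def)
qed

text \<open>The only new candidates are \<open>(s, inv s \<otimes> g)\<close> and
  \<open>(g \<otimes> inv s, s)\<close>. As \<open>s\<close> lies in \<open>H\<close>, both
  cofactors lie in the coset of \<open>g\<close>, so either both are in the union or neither is. The
  pair \<open>(s, s)\<close> never occurs, because its product lies in \<open>H\<close> and
  \<open>g\<close> does not.\<close>

lemma (in normal) product_ways_insert:
  assumes fin: "finite (carrier G)" and P: "P \<subseteq> carrier (G Mod H)" and "H \<notin> P"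
    and s: "s \<in> H" and g: "g \<in> carrier G - H"
  shows "product_ways G (insert s (\<Union>P)) g =
    product_ways G (\<Union>P) g + (if H #> g \<in> P then 2 else 0)"
proof -
  define D where "D = \<Union>P"
  have U: "D = {x \<in> carrier G. H #> x \<in> P}"
    using P by (simp add: D_def Union_cosets)
  have sG: "s \<in> carrier G" using s by simp
  have finD: "finite D" using fin by (simp add: U)
  have Hs: "H #> s = H" "H #> inv s = H"
    using s by (auto simp: coset_join2 is_subgroup)
  then have sD: "s \<notin> D" using \<open>H \<notin> P\<close> by (simp add: U)
  have ss: "s \<otimes> s \<noteq> g" using s g by auto
  have left: "H #> (inv s \<otimes> g) = H #> g"
    using g sG Hs by (metis DiffD1 coset_mult_assoc inv_closed subset)
  \<comment> \<open>Here \<open>inv s\<close> stands on the far side from \<open>H\<close>, so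
    normality enters through the product of cosets, where the coset of \<open>inv s\<close> is the
    identity.\<close>
  have right: "H #> (g \<otimes> inv s) = H #> g"
  proof -
    have "H #> (g \<otimes> inv s) = (H #> g) <#> (H #> inv s)"
      using g sG by (simp add: rcos_sum)
    also have "\<dots> = (H #> g) <#> (H #> \<one>)"
      by (simp only: Hs coset_mult_one[OF subset])
    also have "\<dots> = H #> (g \<otimes> \<one>)"
      using g by (intro rcos_sum) auto
    finally show ?thesis using g by simp
  qed
  let ?W = "{(x, y) \<in> D \<times> D. x \<otimes> y = g}"
  let ?E = "if H #> g \<in> P then {(s, inv s \<otimes> g), (g \<otimes> inv s, s)} else {}"
  have solve_left: "s \<otimes> y = g \<longleftrightarrow> y = inv s \<otimes> g" if "y \<in> carrier G" for y
    using that g sG by (metis DiffD1 inv_solve_left)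
  have solve_right: "x \<otimes> s = g \<longleftrightarrow> x = g \<otimes> inv s" if "x \<in> carrier G" for x
    using that g sG by (metis DiffD1 inv_solve_right)
  have split: "{(x, y) \<in> insert s D \<times> insert s D. x \<otimes> y = g} = ?W \<union> ?E"
  proof -
    have DG: "x \<in> carrier G" if "x \<in> D" for x using that by (simp add: U)
    have mL: "inv s \<otimes> g \<in> D \<longleftrightarrow> H #> g \<in> P" using left g sG by (simp add: U)
    have mR: "g \<otimes> inv s \<in> D \<longleftrightarrow> H #> g \<in> P" using right g sG by (simp add: U)
    have mem: "x \<in> insert s D \<and> y \<in> insert s D \<and> x \<otimes> y = g \<longleftrightarrow> (x, y) \<in> ?W \<union> ?E" for x y
    proof (cases "x = s")
      case True
      have "(s, y) \<notin> ?W" using sD by blast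
      \<comment> \<open>The other pair of \<open>?E\<close> has first entry \<open>s\<close> only if
        \<open>s \<otimes> s = g\<close>, which \<open>ss\<close> excludes.\<close>
      moreover have "(s, y) \<in> ?E \<longleftrightarrow> H #> g \<in> P \<and> y = inv s \<otimes> g"
        using solve_right[OF sG] ss by auto
      moreover have "y \<in> insert s D \<and> s \<otimes> y = g \<longleftrightarrow> H #> g \<in> P \<and> y = inv s \<otimes> g"
        using mL ss solve_left DG by (metis insert_iff)
      ultimately show ?thesis
        using True by blast
    next
      case False
      have "(x, y) \<in> ?E \<longleftrightarrow> H #> g \<in> P \<and> x = g \<otimes> inv s \<and> y = s"
        using False by auto
      moreover have "x \<in> D \<and> x \<otimes> s = g \<longleftrightarrow> H #> g \<in> P \<and> x = g \<otimes> inv s"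
        using mR solve_right DG by metis
      ultimately show ?thesis
        using False sD by blast
    qed
    show ?thesis
    proof (rule Set.set_eqI)
      fix p
      show "p \<in> {(x, y) \<in> insert s D \<times> insert s D. x \<otimes> y = g} \<longleftrightarrow> p \<in> ?W \<union> ?E"
        using mem[of "fst p" "snd p"]
        by (cases p) (simp only: mem_Collect_eq case_prod_conv mem_Times_iff fst_conv snd_conv conj_assoc)
    qed
  qed
  have "finite ?W"
    by (rule finite_subset[of _ "D \<times> D"]) (use finD in auto)
  moreover have "?W \<inter> ?E = {}" using sD by auto
  moreover have "card ?E = (if H #> g \<in> P then 2 else 0)"
  proof -
    \<comment> \<open>This keeps the two pairs in \<open>?E\<close> distinct, so that they count as
      two.\<close>
    have "s \<noteq> g \<otimes> inv s" using solve_right[OF sG] ss by blast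
    then show ?thesis by simp
  qed
  ultimately show ?thesis
    unfolding product_ways_def D_def[symmetric] split by (simp add: card_Un_disjoint)
qed

theorem theorem5p4:
  fixes G :: "('a, 'b) monoid_scheme" and N S :: "'a set" and z :: 'a
    and v k :: nat and \<beta> :: int
  assumes "group G" and "finite (carrier G)" and "order G = 2 * v"
    and "N \<lhd> G" and "N = {\<one>\<^bsub>G\<^esub>, z}" and "card N = 2"
    and "sum_set G (2 * v) (2 * k + 1) (2 * \<beta>) S"
    and "type2 G N S"
  shows "partial_sum_set (G Mod N) v k (\<beta> - 1) \<beta> {s <#\<^bsub>G\<^esub> N | s. s \<in> S - N}"
proof -
  interpret normal N G by fact
  define P where "P = {s <#\<^bsub>G\<^esub> N | s. s \<in> S - N}"
  have fin: "finite (carrier G)" by fact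
  have S: "S \<subseteq> carrier G" and cardS: "card S = 2 * k + 1"
    and ways: "\<And>g. g \<in> carrier G \<Longrightarrow> g \<noteq> \<one>\<^bsub>G\<^esub> \<Longrightarrow> int (product_ways G S g) = 2 * \<beta>"
    using assms(7) by (auto simp: sum_set_def partial_sum_set_def)
  obtain s0 where s0: "S \<inter> N = {s0}"
    using assms(8) by (auto simp: type2_def card_1_singleton_iff)
  \<comment> \<open>Normality replaces the left cosets of the statement by the right cosets that
    make up \<open>G Mod N\<close>.\<close>
  have P_eq: "P = (\<lambda>s. N #>\<^bsub>G\<^esub> s) ` (S - N)"
    using S coset_eq by (auto simp: P_def)
  have PG: "P \<subseteq> carrier (G Mod N)"
    using S by (auto simp: P_eq rcos_in_FactGroup)
  \<comment> \<open>The coset meets \<open>S\<close> in \<open>x\<close>, so the type 2 condition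
    leaves only an intersection of size 2, which is the whole coset.\<close>
  have full: "N #>\<^bsub>G\<^esub> x \<subseteq> S - N" if x: "x \<in> S - N" for x
  proof -
    let ?C = "N #>\<^bsub>G\<^esub> x"
    have xG: "x \<in> carrier G" using x S by blast
    have C: "?C \<in> rcosets\<^bsub>G\<^esub> N" using xG by (auto simp: RCOSETS_def)
    have xC: "x \<in> ?C" by (rule rcos_self[OF xG is_subgroup])
    have ne: "?C \<noteq> N" using x xC by blast
    have finC: "finite ?C"
      using fin r_coset_subset_G[OF subset xG] finite_subset by blast
    have "card (S \<inter> ?C) \<noteq> 0"
      using x xC finC by auto
    then have "card (S \<inter> ?C) = card ?C"
      using assms(8) C ne assms(6) card_rcosets_equal[OF C subset] by (auto simp: type2_def)
    then have "?C \<subseteq> S"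
      using card_subset_eq[OF finC, of "S \<inter> ?C"] by blast
    moreover have "?C \<inter> N = {}"
      using rcos_disjoint[OF is_subgroup] C ne subgroup_in_rcosets[OF is_group]
      by (auto simp: pairwise_def disjnt_def)
    ultimately show ?thesis by blast
  qed
  have UP: "\<Union>P = S - N"
  proof
    show "\<Union>P \<subseteq> S - N" using full unfolding P_eq by blast
    show "S - N \<subseteq> \<Union>P" using S rcos_self[OF _ is_subgroup] unfolding P_eq by blast
  qed
  have "\<one>\<^bsub>G\<^esub> \<in> N" by simp
  then have NP: "N \<notin> P" using UP by blast
  have S_eq: "S = insert s0 (\<Union>P)" using s0 UP by blast
  have s0N: "s0 \<in> N" using s0 by blast
  have cardP: "card P = k"
  proof -
    \<comment> \<open>The element \<open>s0\<close> accounts for the odd one in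
      \<open>2 * k + 1\<close>; the other \<open>2 * k\<close> elements form cosets of size
      2.\<close>
    have "card S = Suc (card (\<Union>P))"
      using S_eq UP s0N fin S by (metis DiffD2 card_insert_disjoint finite_Diff finite_subset)
    then show ?thesis
      using card_Union_cosets[OF fin PG] assms(6) cardS by simp
  qed
  have finM: "finite (carrier (G Mod N))"
    using fin by (simp add: FactGroup_def RCOSETS_def)
  have ordM: "order (G Mod N) = v"
    using lagrange[OF is_subgroup] assms(3,6) by (simp add: order_def FactGroup_def)
  have waysM: "int (product_ways (G Mod N) P A) = (if A \<in> P then \<beta> - 1 else \<beta>)"
    if A: "A \<in> carrier (G Mod N)" "A \<noteq> \<one>\<^bsub>G Mod N\<^esub>" for A
  proof -
    obtain g where g: "g \<in> carrier G" "A = N #>\<^bsub>G\<^esub> g"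
      using A by (auto simp: FactGroup_def RCOSETS_def)
    have gN: "g \<notin> N"
      using A g coset_join2[OF _ is_subgroup] by (auto simp: FactGroup_def)
    then have "g \<noteq> \<one>\<^bsub>G\<^esub>" by auto
    \<comment> \<open>The count in \<open>S\<close> is the same whether or not \<open>g\<close> lies
      in \<open>S\<close>. The two ways through \<open>s0\<close> arise only for \<open>A\<close> in
      \<open>P\<close>, and after halving they cause the drop from \<beta> to
      \<open>\<beta> - 1\<close>.\<close>
    then have "2 * \<beta> = int (product_ways G S g)"
      using ways g by simp
    also have "product_ways G S g =
        2 * product_ways (G Mod N) P A + (if A \<in> P then 2 else 0)"
      using product_ways_insert[OF fin PG NP s0N, of g] g gN
        product_ways_Union_cosets[OF fin PG, of g] assms(6) by (simp add: S_eq)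
    finally show ?thesis by (auto split: if_splits)
  qed
  have "int (product_ways (G Mod N) P A) = \<beta> - 1" if "A \<in> P" "A \<noteq> \<one>\<^bsub>G Mod N\<^esub>" for A
    using waysM[of A] that PG by auto
  moreover have "int (product_ways (G Mod N) P A) = \<beta>"
    if "A \<in> carrier (G Mod N) - P" "A \<noteq> \<one>\<^bsub>G Mod N\<^esub>" for A
    using waysM[of A] that by auto
  ultimately show ?thesis
    unfolding P_def[symmetric] partial_sum_set_def
    using factorgroup_is_group finM ordM PG cardP by (intro conjI ballI impI)
qed

end
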